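(* Let $(\sigma_j)_{j\in\mathbb{N}}$ be a sequence of positive real numbers. For $\boldsymbol{x},\boldsymbol{y}\in\mathbb{R}^{\mathbb{N}}$ we have $$\sum_{j\in\mathbb{N}}|\ell_j(x_j,y_j)-1|<\infty\quad\Leftrightarrow\quad\boldsymbol{x}-\boldsymbol{y}\in\mathfrak{X}.$$ In particular, $$\sum_{j\in\mathbb{N}}|v_j(x_j)-1|<\infty\quad\Leftrightarrow\quad\boldsymbol{x}\in\mathfrak{X}.$$
   Context: For $j\in\mathbb{N}$ and $x,y\in\mathbb{R}$: $\ell_j(x,y):=\exp(-\sigma_j^2(x-y)^2)$ (Gaussian kernel with shape parameter $\sigma_j$) and $v_j(x):=\exp(-\sigma_j^2x^2)$. Moreover, $\mathfrak{X}:=\{\boldsymbol{x}\in\mathbb{R}^{\mathbb{N}}:\sum_{j\in\mathbb{N}}\sigma_j^2x_j^2<\infty\}$. *)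

theory Defs
  imports Complex_Main
begin

text \<open>The kernel \<open>\<ell>\<^sub>j\<close> is \<open>gauss_kernel (\<sigma> j)\<close> and the function \<open>v\<^sub>j\<close> is \<open>gauss_v (\<sigma> j)\<close>.\<close>

definition gauss_kernel :: "real \<Rightarrow> real \<Rightarrow> real \<Rightarrow> real" where
  "gauss_kernel s x y = exp (- (s\<^sup>2 * (x - y)\<^sup>2))"

definition gauss_v :: "real \<Rightarrow> real \<Rightarrow> real" where
  "gauss_v s x = exp (- (s\<^sup>2 * x\<^sup>2))"

text \<open>Finiteness of a series of nonnegative terms is rendered as \<^const>\<open>summable\<close>.\<close>

definition frakX :: "(nat \<Rightarrow> real) \<Rightarrow> (nat \<Rightarrow> real) set" where
  "frakX \<sigma> = {x. summable (\<lambda>j. (\<sigma> j)\<^sup>2 * (x j)\<^sup>2)}"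

end

theory Submission
  imports Defs
begin

text \<open>
  Both equivalences are instances of one fact about a nonnegative sequence \<open>t\<close>: the series of
  \<open>1 - exp (- t j)\<close> and of \<open>t j\<close> converge together, since \<open>1 - exp (- t)\<close> and \<open>t\<close> are
  comparable near \<open>t = 0\<close>. The upper bound \<open>1 - exp (- t) \<le> t\<close> holds everywhere. The
  reverse bound \<open>t \<le> 2 * (1 - exp (- t))\<close> can hold only for small \<open>t\<close>, because the
  left-hand side is unbounded; this is enough, as the terms of a convergent series tend to zero,
  which forces \<open>t j\<close> to be small for all but finitely many \<open>j\<close>. The theorem follows with
  \<open>t j = (\<sigma> j)\<^sup>2 * (x j - y j)\<^sup>2\<close> and \<open>t j = (\<sigma> j)\<^sup>2 * (x j)\<^sup>2\<close>.
\<close>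

text \<open>
  Smallness of \<open>t\<close> is measured by \<open>1 - exp (- t)\<close>, the quantity known to tend to zero in the
  application. Writing \<open>u\<close> for it, \<open>1 + t \<le> exp t\<close> gives \<open>(1 - u) * (1 + t) \<le> 1\<close>, that is
  \<open>(1 - u) * t \<le> u\<close>, and \<open>1 - u \<ge> 1 / 2\<close>.
\<close>

lemma le_twice_one_minus_exp_minus:
  fixes t :: real
  assumes "0 \<le> t" and "1 - exp (- t) \<le> 1 / 2"
  shows "t \<le> 2 * (1 - exp (- t))"
proof -
  have "exp (- t) * (1 + t) \<le> exp (- t) * exp t"
    by (intro mult_left_mono exp_ge_add_one_self) simp
  also have "\<dots> = 1"
    by (simp flip: exp_add)
  finally have "exp (- t) * t \<le> 1 - exp (- t)"
    by (simp add: algebra_simps)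
  moreover have "1 / 2 * t \<le> exp (- t) * t"
    using assms by (intro mult_right_mono) auto
  ultimately show ?thesis
    by simp
qed

lemma summable_abs_exp_minus_diff_one_iff:
  fixes t :: "nat \<Rightarrow> real"
  assumes nonneg: "\<And>j. 0 \<le> t j"
  shows "summable (\<lambda>j. \<bar>exp (- t j) - 1\<bar>) \<longleftrightarrow> summable t"
proof -
  have abs_eq: "\<bar>exp (- t j) - 1\<bar> = 1 - exp (- t j)" for j
    using nonneg[of j] by simp
  show ?thesis
    unfolding abs_eq
  proof
    assume "summable t"
    moreover have "norm (1 - exp (- t j)) \<le> t j" for j
      using nonneg[of j] exp_ge_add_one_self[of "- t j"] by simp
    ultimately show "summable (\<lambda>j. 1 - exp (- t j))"
      by (rule summable_comparison_test'[where N = 0])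
  next
    assume sum: "summable (\<lambda>j. 1 - exp (- t j))"
    then have "(\<lambda>j. 1 - exp (- t j)) \<longlonglongrightarrow> 0"
      by (rule summable_LIMSEQ_zero)
    then have "\<forall>\<^sub>F j in sequentially. 1 - exp (- t j) < 1 / 2"
      by (rule order_tendstoD) simp
    then have "\<forall>\<^sub>F j in sequentially. norm (t j) \<le> 2 * (1 - exp (- t j))"
    proof eventually_elim
      case (elim j)
      then show ?case
        using le_twice_one_minus_exp_minus[OF nonneg[of j]] nonneg[of j] by simp
    qed
    then show "summable t"
      using summable_mult[OF sum, of 2] by (rule summable_comparison_test_ev)
  qed
qed

theorem lemma4p2:
  fixes \<sigma> x y :: "nat \<Rightarrow> real"
  assumes "\<And>j. \<sigma> j > 0"
  shows "(summable (\<lambda>j. \<bar>gauss_kernel (\<sigma> j) (x j) (y j) - 1\<bar>) \<longleftrightarrow> x - y \<in> frakX \<sigma>)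
       \<and> (summable (\<lambda>j. \<bar>gauss_v (\<sigma> j) (x j) - 1\<bar>) \<longleftrightarrow> x \<in> frakX \<sigma>)"
proof
  show "summable (\<lambda>j. \<bar>gauss_kernel (\<sigma> j) (x j) (y j) - 1\<bar>) \<longleftrightarrow> x - y \<in> frakX \<sigma>"
    unfolding gauss_kernel_def frakX_def mem_Collect_eq minus_apply
    by (rule summable_abs_exp_minus_diff_one_iff) simp
  show "summable (\<lambda>j. \<bar>gauss_v (\<sigma> j) (x j) - 1\<bar>) \<longleftrightarrow> x \<in> frakX \<sigma>"
    unfolding gauss_v_def frakX_def mem_Collect_eq
    by (rule summable_abs_exp_minus_diff_one_iff) simp
qed

end
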